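(* Let $\Delta$ be a pure two-dimensional simplicial complex on $n\ge 6$ vertices. Then $I_\Delta^{(2)}=I_\Delta^2$ if and only if $\Delta$ satisfies all of the following conditions: (i) $\overline{\Delta_1}$ does not contain a complete graph $K_3$ as a subgraph. (ii) Whenever $a,b,c,d$ are four distinct vertices with $\{a,b,c\},\{a,b,d\},\{a,c,d\}\notin\Delta$, at least one of the sets $\{a,b\},\{a,c\},\{a,d\}$ does not belong to $\Delta$. (iii) Whenever $a,b,c,d$ are four distinct vertices with $\{a,b,c\},\{a,b,d\},\{a,c,d\},\{b,c,d\}\notin\Delta$, the set $\{a,b,c,d\}$ can be partitioned into two nonfaces of $\Delta$ of two vertices each. (iv) Every set of $5$ vertices can be partitioned into two nonfaces of $\Delta$, one of two vertices and one of three vertices.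
   Context: Let $K$ be a field and $R=K[x_1,\dots,x_n]$. A simplicial complex $\Delta$ on the vertex set $[n]=\{1,\dots,n\}$ is assumed to satisfy $\{i\}\in\Delta$ for every $i\in[n]$. A facet is a maximal face; $\mathcal F(\Delta)$ is the set of facets; $\Delta$ is pure if all facets have the same dimension. A nonface is a subset of $[n]$ not belonging to $\Delta$. The Stanley-Reisner ideal is $I_\Delta=(x_{i_1}\cdots x_{i_s} : \{i_1,\dots,i_s\}\notin\Delta)$. The $m$-th symbolic power is $I_\Delta^{(m)}=\bigcap_{F\in\mathcal F(\Delta)}P_F^m$, where $P_F=(x_i : i\notin F)$. $\Delta_1$ denotes the graph on $[n]$ whose edges are the two-element faces of $\Delta$, and $\overline{\Delta_1}$ is its complement graph on $[n]$ (the graph of non-edges). *)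

theory Defs
  imports
    "HOL-Library.Poly_Mapping"
    "HOL-Library.Ramsey"
    "HOL-Algebra.Ideal_Product"
begin

section \<open>The polynomial ring over a field in n variables\<close>

text \<open>Polynomials over \<open>'k\<close> in countably many variables \<open>x\<^sub>0, x\<^sub>1, \<dots>\<close>: finitely supported
  functions from exponent vectors to coefficients, with the convolution product. The ring
  \<open>K[x\<^sub>1, \<dots>, x\<^sub>n]\<close> is the subring of those polynomials that only involve \<open>x\<^sub>1, \<dots>, x\<^sub>n\<close>; all
  ideals below are ideals of this subring.\<close>

type_synonym 'k mpoly = "(nat \<Rightarrow>\<^sub>0 nat) \<Rightarrow>\<^sub>0 'k"

definition var :: "nat \<Rightarrow> 'k::field mpoly"
  where "var i = Poly_Mapping.single (Poly_Mapping.single i 1) 1"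

definition polynomial_ring :: "nat \<Rightarrow> 'k::field mpoly ring"
  where "polynomial_ring n =
    \<lparr> carrier = {p. \<forall>m \<in> Poly_Mapping.keys p. Poly_Mapping.keys m \<subseteq> {1..n}},
      mult = (*), one = 1, zero = 0, add = (+) \<rparr>"

lemma cring_polynomial_ring: "cring (polynomial_ring n :: 'k::field mpoly ring)"
proof -
  let ?R = "polynomial_ring n :: 'k mpoly ring"
  have carrier_iff: "p \<in> carrier ?R \<longleftrightarrow>
      (\<forall>m \<in> Poly_Mapping.keys p. Poly_Mapping.keys m \<subseteq> {1..n})" for p
    by (simp add: polynomial_ring_def)
  have ops [simp]: "p \<otimes>\<^bsub>?R\<^esub> q = p * q" "p \<oplus>\<^bsub>?R\<^esub> q = p + q" "\<one>\<^bsub>?R\<^esub> = 1" "\<zero>\<^bsub>?R\<^esub> = 0" for p q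
    by (simp_all add: polynomial_ring_def)
  have zero: "0 \<in> carrier ?R" and one: "1 \<in> carrier ?R"
    by (simp_all add: carrier_iff)
  have add: "p + q \<in> carrier ?R" if "p \<in> carrier ?R" "q \<in> carrier ?R" for p q
    using that Poly_Mapping.keys_add[of p q] unfolding carrier_iff by blast
  have uminus: "- p \<in> carrier ?R" if "p \<in> carrier ?R" for p
    using that by (simp add: carrier_iff)
  have mult: "p * q \<in> carrier ?R" if p: "p \<in> carrier ?R" and q: "q \<in> carrier ?R" for p q
    unfolding carrier_iff
  proof
    fix m assume "m \<in> Poly_Mapping.keys (p * q)"
    with Poly_Mapping.keys_mult[of p q] obtain a b
      where m: "m = a + b" and "a \<in> Poly_Mapping.keys p" "b \<in> Poly_Mapping.keys q"
      by blast
    with p q have "Poly_Mapping.keys a \<union> Poly_Mapping.keys b \<subseteq> {1..n}"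
      unfolding carrier_iff by blast
    with Poly_Mapping.keys_add[of a b] show "Poly_Mapping.keys m \<subseteq> {1..n}"
      unfolding m by (rule order_trans)
  qed
  have "abelian_group ?R"
  proof (rule abelian_groupI)
    fix p assume "p \<in> carrier ?R"
    then show "\<exists>q \<in> carrier ?R. q \<oplus>\<^bsub>?R\<^esub> p = \<zero>\<^bsub>?R\<^esub>"
      by (intro bexI[of _ "- p"]) (simp_all add: uminus)
  qed (simp_all add: zero add ac_simps)
  moreover have "Group.comm_monoid ?R"
    by (rule Group.comm_monoidI) (simp_all add: one mult ac_simps)
  ultimately show ?thesis
    by (rule cringI) (simp add: distrib_right)
qed

section \<open>Simplicial complexes\<close>

definition simplicial_complex :: "nat \<Rightarrow> nat set set \<Rightarrow> bool"
  where "simplicial_complex n \<Delta> \<longleftrightarrow>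
    \<Delta> \<noteq> {} \<and> \<Delta> \<subseteq> Pow {1..n} \<and> (\<forall>F \<in> \<Delta>. \<forall>G. G \<subseteq> F \<longrightarrow> G \<in> \<Delta>) \<and> (\<forall>i \<in> {1..n}. {i} \<in> \<Delta>)"

definition facets :: "nat set set \<Rightarrow> nat set set"
  where "facets \<Delta> = {F \<in> \<Delta>. \<forall>G \<in> \<Delta>. F \<subseteq> G \<longrightarrow> G = F}"

text \<open>Dimensions are integers because the empty face has dimension \<open>-1\<close>.\<close>

definition face_dim :: "nat set \<Rightarrow> int"
  where "face_dim F = int (card F) - 1"

definition complex_dim :: "nat set set \<Rightarrow> int"
  where "complex_dim \<Delta> = Max (face_dim ` \<Delta>)"

definition pure :: "nat set set \<Rightarrow> bool"
  where "pure \<Delta> \<longleftrightarrow> (\<forall>F \<in> facets \<Delta>. \<forall>G \<in> facets \<Delta>. face_dim F = face_dim G)"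

definition nonfaces :: "nat \<Rightarrow> nat set set \<Rightarrow> nat set set"
  where "nonfaces n \<Delta> = {S. S \<subseteq> {1..n} \<and> S \<notin> \<Delta>}"

definition skeleton_graph :: "nat set set \<Rightarrow> nat set set"
  where "skeleton_graph \<Delta> = {e \<in> \<Delta>. card e = 2}"

definition complement_graph :: "nat \<Rightarrow> nat set set \<Rightarrow> nat set set"
  where "complement_graph n E = nsets {1..n} 2 - E"

definition contains_complete_graph :: "nat \<Rightarrow> nat set set \<Rightarrow> nat \<Rightarrow> bool"
  where "contains_complete_graph n E k \<longleftrightarrow> (\<exists>T \<subseteq> {1..n}. card T = k \<and> clique T E)"

definition partitioned_into_nonfaces ::
  "nat \<Rightarrow> nat set set \<Rightarrow> nat set \<Rightarrow> nat \<Rightarrow> nat \<Rightarrow> bool"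
  where "partitioned_into_nonfaces n \<Delta> W r s \<longleftrightarrow>
    (\<exists>A \<in> nonfaces n \<Delta>. \<exists>B \<in> nonfaces n \<Delta>.
       A \<union> B = W \<and> A \<inter> B = {} \<and> card A = r \<and> card B = s)"

section \<open>Stanley-Reisner ideals and symbolic powers\<close>

definition ideal_power :: "nat \<Rightarrow> 'k::field mpoly set \<Rightarrow> nat \<Rightarrow> 'k mpoly set"
  where "ideal_power n I m = I [^]\<^bsub>ideals_set (polynomial_ring n)\<^esub> m"

definition stanley_reisner_ideal :: "nat \<Rightarrow> nat set set \<Rightarrow> 'k::field mpoly set"
  where "stanley_reisner_ideal n \<Delta> =
    genideal (polynomial_ring n) ((\<lambda>S. \<Prod>i\<in>S. var i) ` nonfaces n \<Delta>)"

definition facet_prime :: "nat \<Rightarrow> nat set \<Rightarrow> 'k::field mpoly set"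
  where "facet_prime n F = genideal (polynomial_ring n) (var ` ({1..n} - F))"

definition symbolic_power :: "nat \<Rightarrow> nat set set \<Rightarrow> nat \<Rightarrow> 'k::field mpoly set"
  where "symbolic_power n \<Delta> m = (\<Inter>F \<in> facets \<Delta>. ideal_power n (facet_prime n F) m)"

end

theory Submission
  imports Defs
begin

text \<open>All ideals involved are spanned by monomials. The monomial with exponent vector \<open>m\<close> lies in
  the second symbolic power iff every face omits \<open>i\<close> and \<open>j\<close> (possibly equal) with \<open>x\<^sub>i x\<^sub>j\<close> dividing
  it, and in the square of the Stanley-Reisner ideal iff it is divisible by the product of two
  monomials supported on nonfaces. Conditions (i), (iii) and (iv) are read off from squarefree
  monomials, (ii) from \<open>x\<^sub>a\<^sup>2 x\<^sub>b x\<^sub>c x\<^sub>d\<close>. Conversely let \<open>V\<close> be the support of \<open>m\<close> and \<open>W\<close> the set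
  where \<open>m \<ge> 2\<close>. If \<open>W\<close> is a nonface or \<open>\<bar>V\<bar> \<ge> 5\<close>, we are done (by (iv) in the second case). Otherwise
  a face \<open>F\<close> containing \<open>W\<close> leaves at least two elements of \<open>V\<close> uncovered, so \<open>\<bar>W\<bar> + 2 \<le> \<bar>V\<bar> \<le> 4\<close> and
  every subset of \<open>V\<close> of size at least \<open>\<bar>V\<bar> - 1\<close> containing \<open>W\<close> is a nonface; this leaves five cases.\<close>

section \<open>Monomial ideals\<close>

text \<open>Divisibility of monomials, written additively on exponent vectors; the bound on
  \<open>keys k\<close> keeps cofactors within the variables 1 to n.\<close>

definition multiples :: "nat \<Rightarrow> (nat \<Rightarrow>\<^sub>0 nat) set \<Rightarrow> (nat \<Rightarrow>\<^sub>0 nat) set"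
  where "multiples n G = {k. Poly_Mapping.keys k \<subseteq> {1..n} \<and> (\<exists>g\<in>G. \<exists>h. k = g + h)}"

text \<open>Membership is tested on each monomial separately, so that ideals can be compared
  exponent by exponent; \<open>genideal_monomials\<close> identifies this set with a generated
  ideal.\<close>

definition monomial_ideal :: "nat \<Rightarrow> (nat \<Rightarrow>\<^sub>0 nat) set \<Rightarrow> 'k::field mpoly set"
  where "monomial_ideal n G = {p. Poly_Mapping.keys p \<subseteq> multiples n G}"

lemma polynomial_ring_simps [simp]:
  "p \<otimes>\<^bsub>polynomial_ring n\<^esub> q = p * q" "p \<oplus>\<^bsub>polynomial_ring n\<^esub> q = p + q"
  "\<one>\<^bsub>polynomial_ring n\<^esub> = 1" "\<zero>\<^bsub>polynomial_ring n\<^esub> = 0"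
  by (simp_all add: polynomial_ring_def)

lemma carrier_polynomial_ring:
  "carrier (polynomial_ring n) = {p. \<forall>m \<in> Poly_Mapping.keys p. Poly_Mapping.keys m \<subseteq> {1..n}}"
  by (simp add: polynomial_ring_def)

lemma keys_plus_nat: "Poly_Mapping.keys (a + b) = Poly_Mapping.keys a \<union> Poly_Mapping.keys b"
  for a b :: "'a \<Rightarrow>\<^sub>0 nat"
  by (auto simp: in_keys_iff lookup_add)

lemma multiplesI:
  "Poly_Mapping.keys (g + h) \<subseteq> {1..n} \<Longrightarrow> g \<in> G \<Longrightarrow> g + h \<in> multiples n G"
  by (auto simp: multiples_def)

lemma multiples_iff_lookup_le:
  "k \<in> multiples n G \<longleftrightarrow> Poly_Mapping.keys k \<subseteq> {1..n} \<and>
     (\<exists>g\<in>G. \<forall>i. Poly_Mapping.lookup g i \<le> Poly_Mapping.lookup k i)"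
proof -
  have "(\<exists>h. k = g + h) \<longleftrightarrow> (\<forall>i. Poly_Mapping.lookup g i \<le> Poly_Mapping.lookup k i)" for g
  proof
    assume "\<forall>i. Poly_Mapping.lookup g i \<le> Poly_Mapping.lookup k i"
    then have "k = g + (k - g)"
      by (intro poly_mapping_eqI) (simp add: lookup_add lookup_minus)
    then show "\<exists>h. k = g + h" ..
  qed (auto simp: lookup_add)
  then show ?thesis by (simp add: multiples_def)
qed

text \<open>A polynomial is the finite sum of its terms. This reduces the inclusion of a monomial
  ideal in a generated ideal or in an ideal product to single terms.\<close>

lemma mem_of_terms_mem:
  fixes p :: "'a \<Rightarrow>\<^sub>0 'b::comm_monoid_add"
  assumes "0 \<in> J" "\<And>a b. a \<in> J \<Longrightarrow> b \<in> J \<Longrightarrow> a + b \<in> J"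
    and "\<And>k. k \<in> Poly_Mapping.keys p \<Longrightarrow>
      Poly_Mapping.single k (Poly_Mapping.lookup p k) \<in> J"
  shows "p \<in> J"
proof -
  have p: "(\<Sum>k\<in>Poly_Mapping.keys p. Poly_Mapping.single k (Poly_Mapping.lookup p k)) = p"
    by (rule poly_mapping_eqI)
      (auto simp: lookup_sum lookup_single when_def in_keys_iff sum.delta)
  have "(\<Sum>k\<in>A. Poly_Mapping.single k (Poly_Mapping.lookup p k)) \<in> J"
    if "A \<subseteq> Poly_Mapping.keys p" for A
    using finite_subset[OF that finite_keys] that
    by (induction rule: finite_induct) (auto intro: assms)
  from this[of "Poly_Mapping.keys p"] have "(\<Sum>k\<in>Poly_Mapping.keys p.
      Poly_Mapping.single k (Poly_Mapping.lookup p k)) \<in> J" by simp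
  then show ?thesis by (simp only: p)
qed

text \<open>Every exponent of \<open>x * a\<close> is a sum \<open>u + v\<close> with
  \<open>v\<close> an exponent of \<open>a\<close>, so a generator dividing \<open>v\<close> divides
  it as well.\<close>

lemma ideal_monomial_ideal:
  "ideal (monomial_ideal n G :: 'k::field mpoly set) (polynomial_ring n)"
proof (rule idealI)
  let ?R = "polynomial_ring n :: 'k mpoly ring"
  let ?I = "monomial_ideal n G :: 'k mpoly set"
  interpret cring ?R by (rule cring_polynomial_ring)
  show "ring ?R" by (rule ring_axioms)
  have sub: "?I \<subseteq> carrier ?R"
    by (auto simp: monomial_ideal_def multiples_def carrier_polynomial_ring)
  have mult: "x * a \<in> ?I" if a: "a \<in> ?I" and x: "x \<in> carrier ?R" for a x
    unfolding monomial_ideal_def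
  proof (clarify)
    fix k assume "k \<in> Poly_Mapping.keys (x * a)"
    then obtain u v where uv: "k = u + v" "u \<in> Poly_Mapping.keys x" "v \<in> Poly_Mapping.keys a"
      using keys_mult[of x a] by blast
    then obtain g h where "v = g + h" "g \<in> G" and v: "Poly_Mapping.keys v \<subseteq> {1..n}"
      using a by (auto simp: monomial_ideal_def multiples_def)
    moreover have "Poly_Mapping.keys u \<subseteq> {1..n}"
      using x uv by (auto simp: carrier_polynomial_ring)
    ultimately show "k \<in> multiples n G"
      using multiplesI[of g "h + u" n G] uv(1) by (simp add: keys_plus_nat ac_simps)
  qed
  show "x \<otimes>\<^bsub>?R\<^esub> a \<in> ?I" "a \<otimes>\<^bsub>?R\<^esub> x \<in> ?I" if "a \<in> ?I" "x \<in> carrier ?R" for a x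
    using mult[OF that] by (simp_all add: mult.commute)
  show "subgroup ?I (add_monoid ?R)"
  proof (rule add.subgroupI)
    show "?I \<noteq> {}" by (auto simp: monomial_ideal_def intro!: exI[of _ 0])
    show "\<ominus>\<^bsub>?R\<^esub> a \<in> ?I" if a: "a \<in> ?I" for a
    proof -
      have "- a \<in> ?I" using a by (simp add: monomial_ideal_def)
      \<comment> \<open>The inverse of the ring record is identified with the unary minus of the
        type by uniqueness of additive inverses.\<close>
      moreover have "\<ominus>\<^bsub>?R\<^esub> a = - a"
        using a sub calculation by (intro minus_equality) auto
      ultimately show ?thesis by simp
    qed
    show "a \<oplus>\<^bsub>?R\<^esub> b \<in> ?I" if "a \<in> ?I" "b \<in> ?I" for a b
      using that keys_add[of a b] by (auto simp: monomial_ideal_def)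
  qed (use sub in simp)
qed

lemma single_mem_monomial_ideal:
  "c \<noteq> 0 \<Longrightarrow> Poly_Mapping.single k c \<in> monomial_ideal n G \<longleftrightarrow> k \<in> multiples n G"
  by (simp add: monomial_ideal_def)

text \<open>One inclusion is minimality of the generated ideal. For the other, a term with exponent
  \<open>g + h\<close> is the generator with exponent \<open>g\<close> times a term with exponent
  \<open>h\<close>.\<close>

lemma genideal_monomials:
  assumes G: "\<And>g. g \<in> G \<Longrightarrow> Poly_Mapping.keys g \<subseteq> {1..n}"
  shows "genideal (polynomial_ring n) ((\<lambda>g. Poly_Mapping.single g 1) ` G)
    = (monomial_ideal n G :: 'k::field mpoly set)" (is "genideal ?R ?M = ?I")
proof
  interpret cring ?R by (rule cring_polynomial_ring)
  show "genideal ?R ?M \<subseteq> ?I"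
  proof (rule genideal_minimal[OF ideal_monomial_ideal])
    have "g \<in> multiples n G" if "g \<in> G" for g
      using multiplesI[of g 0 n G] G that by simp
    then show "?M \<subseteq> ?I" by (auto simp: single_mem_monomial_ideal)
  qed
  have M: "?M \<subseteq> carrier ?R"
    using subsetD[OF G] by (auto simp: carrier_polynomial_ring)
  then interpret J: ideal "genideal ?R ?M" ?R by (rule genideal_ideal)
  show "?I \<subseteq> genideal ?R ?M"
  proof
    fix p :: "'k mpoly" assume p: "p \<in> ?I"
    show "p \<in> genideal ?R ?M"
    proof (rule mem_of_terms_mem)
      show "0 \<in> genideal ?R ?M" using J.zero_closed by simp
      show "a + b \<in> genideal ?R ?M" if "a \<in> genideal ?R ?M" "b \<in> genideal ?R ?M" for a b
        using J.a_closed[OF that] by simp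
      fix k assume "k \<in> Poly_Mapping.keys p"
      then obtain g h where k: "k = g + h" "g \<in> G" "Poly_Mapping.keys k \<subseteq> {1..n}"
        using p by (auto simp: monomial_ideal_def multiples_def)
      let ?c = "Poly_Mapping.lookup p k"
      have "Poly_Mapping.single h ?c \<in> carrier ?R"
        using k by (simp add: carrier_polynomial_ring keys_plus_nat)
      moreover have "Poly_Mapping.single g 1 \<in> genideal ?R ?M"
        using genideal_self[OF M] k(2) by blast
      ultimately have "Poly_Mapping.single h ?c * Poly_Mapping.single g 1 \<in> genideal ?R ?M"
        using J.I_l_closed by fastforce
      then show "Poly_Mapping.single k ?c \<in> genideal ?R ?M"
        by (simp add: mult_single k(1) add.commute)
    qed
  qed
qed

lemma ideal_power_2:
  fixes I :: "'k::field mpoly set"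
  assumes "ideal I (polynomial_ring n)"
  shows "ideal_power n I 2 = ideal_prod (polynomial_ring n) I I"
proof -
  let ?R = "polynomial_ring n :: 'k mpoly ring"
  interpret cring ?R by (rule cring_polynomial_ring)
  interpret S: comm_monoid "ideals_set ?R" by (rule ideals_set_is_comm_monoid)
  have "I \<in> carrier (ideals_set ?R)"
    using assms by (simp add: ideals_set_def)
  \<comment> \<open>The power unfolds to unit times \<open>I\<close> times \<open>I\<close>. The
    first call drops the unit by the monoid laws, the second turns the remaining multiplication into
    \<open>ideal_prod\<close>.\<close>
  then show ?thesis
    by (simp add: ideal_power_def numeral_2_eq_2) (simp add: ideals_set_def)
qed

lemma ideal_power_2_monomial_ideal:
  assumes G: "\<And>g. g \<in> G \<Longrightarrow> Poly_Mapping.keys g \<subseteq> {1..n}"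
  shows "ideal_power n (monomial_ideal n G :: 'k::field mpoly set) 2
    = monomial_ideal n {g + h | g h. g \<in> G \<and> h \<in> G}" (is "_ = ?Q")
proof -
  let ?R = "polynomial_ring n :: 'k mpoly ring"
  let ?I = "monomial_ideal n G :: 'k mpoly set"
  have "ideal_prod ?R ?I ?I = ?Q"
  proof
    show "ideal_prod ?R ?I ?I \<subseteq> ?Q"
    proof
      fix p assume "p \<in> ideal_prod ?R ?I ?I"
      then show "p \<in> ?Q"
      proof induction
        case (prod a b)
        show ?case
          unfolding monomial_ideal_def
        proof (clarsimp)
          fix k assume "k \<in> Poly_Mapping.keys (a * b)"
          then obtain u v where "k = u + v" and u: "u \<in> multiples n G" and v: "v \<in> multiples n G"
            using keys_mult[of a b] prod unfolding monomial_ideal_def by blast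
          moreover obtain g h where "u = g + h" "g \<in> G"
            using u by (auto simp: multiples_def)
          moreover obtain g' h' where "v = g' + h'" "g' \<in> G"
            using v by (auto simp: multiples_def)
          ultimately show "k \<in> multiples n {g + h | g h. g \<in> G \<and> h \<in> G}"
            using multiplesI[of "g + g'" "h + h'" n "{g + h | g h. g \<in> G \<and> h \<in> G}"]
            by (auto simp: multiples_def keys_plus_nat ac_simps)
        qed
      next
        case (sum a b)
        then show ?case using keys_add[of a b] by (auto simp: monomial_ideal_def)
      qed
    qed
    show "?Q \<subseteq> ideal_prod ?R ?I ?I"
    proof
      fix p assume p: "p \<in> ?Q"
      show "p \<in> ideal_prod ?R ?I ?I"
      proof (rule mem_of_terms_mem)
        have "0 \<in> ?I" by (simp add: monomial_ideal_def)
        from ideal_prod.prod[OF this this, of ?R] show "0 \<in> ideal_prod ?R ?I ?I" by simp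
        show "a + b \<in> ideal_prod ?R ?I ?I"
          if "a \<in> ideal_prod ?R ?I ?I" "b \<in> ideal_prod ?R ?I ?I" for a b
          using ideal_prod.sum[OF that] by simp
        fix k assume k: "k \<in> Poly_Mapping.keys p"
        then obtain g g' h where
          gh: "k = g + g' + h" "g \<in> G" "g' \<in> G" "Poly_Mapping.keys k \<subseteq> {1..n}"
          using p by (auto simp: monomial_ideal_def multiples_def)
        let ?c = "Poly_Mapping.lookup p k"
        \<comment> \<open>The term is split into the generator with exponent \<open>g\<close> and a
          second factor that takes \<open>g'\<close>, the cofactor \<open>h\<close> and the
          coefficient.\<close>
        have "g \<in> multiples n G" "g' + h \<in> multiples n G"
          using multiplesI[of g 0 n G] multiplesI[of g' h n G] gh
          by (auto simp: keys_plus_nat)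
        then have "Poly_Mapping.single g 1 \<in> ?I" "Poly_Mapping.single (g' + h) ?c \<in> ?I"
          using k by (auto simp: single_mem_monomial_ideal in_keys_iff)
        from ideal_prod.prod[OF this, of ?R] show "Poly_Mapping.single k ?c \<in> ideal_prod ?R ?I ?I"
          by (simp add: mult_single gh(1) add.assoc)
      qed
    qed
  qed
  then show ?thesis by (simp only: ideal_power_2[OF ideal_monomial_ideal])
qed

section \<open>Squarefree exponent vectors\<close>

definition exponent_vector :: "nat set \<Rightarrow> (nat \<Rightarrow>\<^sub>0 nat)"
  where "exponent_vector S = (\<Sum>i\<in>S. Poly_Mapping.single i 1)"

text \<open>Divisibility of the monomial with exponents \<open>m\<close> by the product of the
  squarefree monomials on \<open>S\<close> and \<open>T\<close>. Plain functions \<open>m\<close>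
  are used so that test monomials can be written down directly.\<close>

definition covers :: "(nat \<Rightarrow> nat) \<Rightarrow> nat set \<Rightarrow> nat set \<Rightarrow> bool"
  where "covers m S T \<longleftrightarrow> (\<forall>i. of_bool (i \<in> S) + of_bool (i \<in> T) \<le> m i)"

text \<open>The two indicators add up to at most 2, so only the sets where \<open>m\<close> is at
  least 1 and at least 2 matter.\<close>

lemma coversI:
  "(\<And>i. i \<in> S \<Longrightarrow> 0 < m i) \<Longrightarrow> (\<And>i. i \<in> T \<Longrightarrow> 0 < m i) \<Longrightarrow>
    (\<And>i. i \<in> S \<Longrightarrow> i \<in> T \<Longrightarrow> 2 \<le> m i) \<Longrightarrow> covers m S T"
  by (force simp: covers_def of_bool_def Suc_le_eq)

lemma covers_pos: "covers m S T \<Longrightarrow> i \<in> S \<union> T \<Longrightarrow> 0 < m i"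
  by (auto simp: covers_def of_bool_def dest!: spec[of _ i] split: if_splits)

lemma covers_ge_2: "covers m S T \<Longrightarrow> i \<in> S \<Longrightarrow> i \<in> T \<Longrightarrow> 2 \<le> m i"
  by (auto simp: covers_def of_bool_def dest!: spec[of _ i] split: if_splits)
lemma lookup_exponent_vector:
  "finite S \<Longrightarrow> Poly_Mapping.lookup (exponent_vector S) i = of_bool (i \<in> S)"
  by (simp add: exponent_vector_def lookup_sum lookup_single when_def sum.delta)

lemma prod_var:
  "finite S \<Longrightarrow> (\<Prod>i\<in>S. var i) = (Poly_Mapping.single (exponent_vector S) 1 :: 'k::field mpoly)"
  by (induction rule: finite_induct)
    (simp_all add: exponent_vector_def var_def mult_single single_one)

text \<open>Serves both sides of the theorem: nonfaces yield the Stanley-Reisner ideal, singletons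
  outside a facet yield its prime.\<close>

lemma ideal_power_2_squarefree:
  assumes "\<And>S. S \<in> A \<Longrightarrow> S \<subseteq> {1..n}"
  shows "ideal_power n (genideal (polynomial_ring n) ((\<lambda>S. \<Prod>i\<in>S. var i) ` A)) 2
    = {p :: 'k::field mpoly. \<forall>k\<in>Poly_Mapping.keys p. Poly_Mapping.keys k \<subseteq> {1..n} \<and>
        (\<exists>S\<in>A. \<exists>T\<in>A. covers (Poly_Mapping.lookup k) S T)}"
proof -
  let ?G = "exponent_vector ` A"
  have fin: "finite S" if "S \<in> A" for S
    using assms[OF that] finite_subset by blast
  have "(\<lambda>S. \<Prod>i\<in>S. var i) ` A = (\<lambda>g. Poly_Mapping.single g 1 :: 'k mpoly) ` ?G"
    unfolding image_image by (intro image_cong) (simp_all add: prod_var fin)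
  moreover have keys: "Poly_Mapping.keys g \<subseteq> {1..n}" if "g \<in> ?G" for g
    using that assms fin by (fastforce simp: in_keys_iff lookup_exponent_vector)
  ultimately have "ideal_power n (genideal (polynomial_ring n) ((\<lambda>S. \<Prod>i\<in>S. var i) ` A)) 2
      = (monomial_ideal n {g + h | g h. g \<in> ?G \<and> h \<in> ?G} :: 'k mpoly set)"
    by (simp only: ideal_power_2_monomial_ideal[of ?G] genideal_monomials[of ?G])
  moreover have "k \<in> multiples n {g + h | g h. g \<in> ?G \<and> h \<in> ?G} \<longleftrightarrow>
      Poly_Mapping.keys k \<subseteq> {1..n} \<and>
      (\<exists>S\<in>A. \<exists>T\<in>A. covers (Poly_Mapping.lookup k) S T)" for k
  proof -
    have "(\<exists>g\<in>{g + h | g h. g \<in> ?G \<and> h \<in> ?G}.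
        \<forall>i. Poly_Mapping.lookup g i \<le> Poly_Mapping.lookup k i) \<longleftrightarrow>
      (\<exists>S\<in>A. \<exists>T\<in>A. \<forall>i. Poly_Mapping.lookup (exponent_vector S + exponent_vector T) i
        \<le> Poly_Mapping.lookup k i)" by blast
    then show ?thesis
      by (simp add: multiples_iff_lookup_le covers_def lookup_add lookup_exponent_vector fin
          cong: bex_cong)
  qed
  ultimately show ?thesis by (auto simp: monomial_ideal_def)
qed

lemma ideal_power_2_facet_prime:
  "ideal_power n (facet_prime n F) 2
    = {p :: 'k::field mpoly. \<forall>k\<in>Poly_Mapping.keys p. Poly_Mapping.keys k \<subseteq> {1..n} \<and>
        (\<exists>i\<in>{1..n} - F. \<exists>j\<in>{1..n} - F. covers (Poly_Mapping.lookup k) {i} {j})}"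
proof -
  have "(var :: nat \<Rightarrow> 'k mpoly) ` ({1..n} - F)
      = (\<lambda>S. \<Prod>i\<in>S. var i) ` (\<lambda>i. {i}) ` ({1..n} - F)"
    by (simp add: image_image)
  then show ?thesis
    unfolding facet_prime_def
    using ideal_power_2_squarefree[of "(\<lambda>i. {i}) ` ({1..n} - F)" n, where 'k = 'k] by auto
qed

section \<open>The combinatorial criterion\<close>

lemma face_subset_facet:
  assumes "simplicial_complex n \<Delta>" "F \<in> \<Delta>"
  shows "\<exists>G\<in>facets \<Delta>. F \<subseteq> G"
proof -
  have "finite \<Delta>"
    using assms(1) finite_subset[of \<Delta> "Pow {1..n}"] by (simp add: simplicial_complex_def)
  from finite_has_maximal2[OF this assms(2)]
  obtain G where G: "G \<in> \<Delta>" "F \<subseteq> G" "\<forall>H\<in>\<Delta>. G \<subseteq> H \<longrightarrow> G = H" by blast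
  then have "G \<in> facets \<Delta>" unfolding facets_def by blast
  then show ?thesis using G(2) by blast
qed

text \<open>Both ideals are determined by a condition on single monomials, so they agree iff the
  conditions do. The square always lies in the symbolic square, which leaves one
  implication.\<close>

lemma symbolic_square_eq_square_iff:
  fixes n :: nat and \<Delta> :: "nat set set"
  assumes sc: "simplicial_complex n \<Delta>"
  shows "(symbolic_power n \<Delta> 2 :: 'k::field mpoly set)
      = ideal_power n (stanley_reisner_ideal n \<Delta>) 2 \<longleftrightarrow>
    (\<forall>m. {i. 0 < m i} \<subseteq> {1..n} \<longrightarrow>
      (\<forall>F\<in>\<Delta>. \<exists>i. \<exists>j. i \<notin> F \<and> j \<notin> F \<and> covers m {i} {j}) \<longrightarrow>
      (\<exists>S\<in>nonfaces n \<Delta>. \<exists>T\<in>nonfaces n \<Delta>. covers m S T))"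
    (is "?L = ?R \<longleftrightarrow> (\<forall>m. ?supp m \<longrightarrow> ?A m \<longrightarrow> ?B m)")
proof -
  \<comment> \<open>Some facet must exist: over an empty family the intersection would lose the
    bound on the support of \<open>m\<close>.\<close>
  obtain F\<^sub>0 where F\<^sub>0: "F\<^sub>0 \<in> facets \<Delta>"
  proof -
    have "{} \<in> \<Delta>" using sc by (auto simp: simplicial_complex_def)
    then show ?thesis using face_subset_facet[OF sc] that by blast
  qed
  \<comment> \<open>Neither nonface fits into the face \<open>F\<close>, so each has an element
    outside it. If the two elements coincide, they lie in \<open>S \<inter> T\<close>, where
    \<open>m\<close> is at least 2.\<close>
  have BA: "?A m" if B: "?B m" for m
  proof
    fix F assume F: "F \<in> \<Delta>"
    obtain S T where ST: "S \<in> nonfaces n \<Delta>" "T \<in> nonfaces n \<Delta>" "covers m S T"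
      using B by blast
    have "\<not> S \<subseteq> F" "\<not> T \<subseteq> F"
      using ST F sc by (auto simp: simplicial_complex_def nonfaces_def)
    then obtain i j where "i \<in> S" "i \<notin> F" "j \<in> T" "j \<notin> F" by blast
    moreover from this have "covers m {i} {j}"
      using covers_pos[OF ST(3)] covers_ge_2[OF ST(3)] by (intro coversI) auto
    ultimately show "\<exists>i. \<exists>j. i \<notin> F \<and> j \<notin> F \<and> covers m {i} {j}" by blast
  qed
  have R: "?R = {p. \<forall>k\<in>Poly_Mapping.keys p. ?supp (Poly_Mapping.lookup k) \<and>
      ?B (Poly_Mapping.lookup k)}"
    unfolding stanley_reisner_ideal_def
    by (subst ideal_power_2_squarefree) (auto simp: nonfaces_def in_keys_iff subset_iff)
  have facet_iff: "(\<forall>F\<in>facets \<Delta>. ?supp m \<and>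
      (\<exists>i\<in>{1..n} - F. \<exists>j\<in>{1..n} - F. covers m {i} {j})) \<longleftrightarrow> ?supp m \<and> ?A m" (is "?A' \<longleftrightarrow> _") for m
  proof
    assume A': ?A'
    have "\<exists>i. \<exists>j. i \<notin> F \<and> j \<notin> F \<and> covers m {i} {j}" if F: "F \<in> \<Delta>" for F
    proof -
      obtain G where "G \<in> facets \<Delta>" "F \<subseteq> G" using face_subset_facet[OF sc F] by blast
      moreover from this(1) obtain i j where "i \<in> {1..n} - G" "j \<in> {1..n} - G" "covers m {i} {j}"
        using bspec[OF A'] by blast
      ultimately show ?thesis by blast
    qed
    moreover have "?supp m" using bspec[OF A' F\<^sub>0] by (rule conjunct1)
    ultimately show "?supp m \<and> ?A m" by blast
  next
    assume A: "?supp m \<and> ?A m"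
    show ?A'
    proof
      fix F assume "F \<in> facets \<Delta>"
      then obtain i j where ij: "i \<notin> F" "j \<notin> F" "covers m {i} {j}"
        using A by (auto simp: facets_def)
      then have "0 < m i" "0 < m j"
        using covers_pos by auto
      then have "i \<in> {1..n} - F" "j \<in> {1..n} - F" using A ij by auto
      then show "?supp m \<and> (\<exists>i\<in>{1..n} - F. \<exists>j\<in>{1..n} - F. covers m {i} {j})"
        using A ij by blast
    qed
  qed
  have supp: "Poly_Mapping.keys k \<subseteq> {1..n} \<longleftrightarrow> ?supp (Poly_Mapping.lookup k)" for k
    by (auto simp: in_keys_iff subset_iff)
  have "?L = {p. \<forall>k\<in>Poly_Mapping.keys p. \<forall>F\<in>facets \<Delta>. ?supp (Poly_Mapping.lookup k) \<and>
      (\<exists>i\<in>{1..n} - F. \<exists>j\<in>{1..n} - F. covers (Poly_Mapping.lookup k) {i} {j})}"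
    unfolding symbolic_power_def ideal_power_2_facet_prime supp by auto
  then have L: "?L = {p. \<forall>k\<in>Poly_Mapping.keys p. ?supp (Poly_Mapping.lookup k) \<and>
      ?A (Poly_Mapping.lookup k)}"
    unfolding facet_iff .
  show ?thesis
  proof
    assume eq: "?L = ?R"
    show "\<forall>m. ?supp m \<longrightarrow> ?A m \<longrightarrow> ?B m"
    proof (intro allI impI)
      fix m assume m: "?supp m" "?A m"
      \<comment> \<open>By its finite support \<open>m\<close> is an exponent vector; the monomial
        with this exponent and coefficient 1 tests the equality.\<close>
      define k where "k = Abs_poly_mapping m"
      have "finite {i. m i \<noteq> 0}" using finite_subset[OF m(1)] by simp
      then have k: "Poly_Mapping.lookup k = m" by (simp add: k_def)
      have "Poly_Mapping.single k 1 \<in> ?L" unfolding L using m by (simp add: k)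
      then have "Poly_Mapping.single k 1 \<in> ?R" using eq by blast
      then show "?B m" unfolding R by (simp add: k)
    qed
  next
    assume AB: "\<forall>m. ?supp m \<longrightarrow> ?A m \<longrightarrow> ?B m"
    have "?supp m \<and> ?A m \<longleftrightarrow> ?supp m \<and> ?B m" for m
      using AB[THEN spec, of m] BA[of m] by argo
    then show "?L = ?R" unfolding L R by (simp only:)
  qed
qed

text \<open>A pair of distinct vertices has two elements, so it is an edge of the complement graph
  exactly when it is a nonface.\<close>

lemma contains_triangle_complement_iff:
  assumes "\<Delta> \<subseteq> Pow {1..n}"
  shows "contains_complete_graph n (complement_graph n (skeleton_graph \<Delta>)) 3 \<longleftrightarrow>
    (\<exists>a\<in>{1..n}. \<exists>b\<in>{1..n}. \<exists>c\<in>{1..n}. distinct [a, b, c] \<and>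
      {a, b} \<notin> \<Delta> \<and> {a, c} \<notin> \<Delta> \<and> {b, c} \<notin> \<Delta>)"
proof -
  have edge: "{v, w} \<in> complement_graph n (skeleton_graph \<Delta>) \<longleftrightarrow> {v, w} \<notin> \<Delta>"
    if "v \<noteq> w" "v \<in> {1..n}" "w \<in> {1..n}" for v w
    using that by (simp add: complement_graph_def skeleton_graph_def nsets_def)
  show ?thesis
  proof
    assume "contains_complete_graph n (complement_graph n (skeleton_graph \<Delta>)) 3"
    then obtain T where T: "T \<subseteq> {1..n}" "card T = 3"
        "clique T (complement_graph n (skeleton_graph \<Delta>))"
      by (auto simp: contains_complete_graph_def)
    then obtain a b c where "T = {a, b, c}" "distinct [a, b, c]"
      by (auto simp: card_3_iff)
    moreover from this have "a \<in> {1..n}" "b \<in> {1..n}" "c \<in> {1..n}" using T(1) by auto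
    ultimately show "\<exists>a\<in>{1..n}. \<exists>b\<in>{1..n}. \<exists>c\<in>{1..n}. distinct [a, b, c] \<and>
        {a, b} \<notin> \<Delta> \<and> {a, c} \<notin> \<Delta> \<and> {b, c} \<notin> \<Delta>"
      using T(3) edge unfolding clique_def
      by (metis distinct_length_2_or_more insertCI)
  next
    assume "\<exists>a\<in>{1..n}. \<exists>b\<in>{1..n}. \<exists>c\<in>{1..n}. distinct [a, b, c] \<and>
        {a, b} \<notin> \<Delta> \<and> {a, c} \<notin> \<Delta> \<and> {b, c} \<notin> \<Delta>"
    then obtain a b c where abc: "a \<in> {1..n}" "b \<in> {1..n}" "c \<in> {1..n}" "distinct [a, b, c]"
      "{a, b} \<notin> \<Delta>" "{a, c} \<notin> \<Delta>" "{b, c} \<notin> \<Delta>" by blast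
    then have "clique {a, b, c} (complement_graph n (skeleton_graph \<Delta>))"
      using edge by (auto simp: clique_def insert_commute)
    then show "contains_complete_graph n (complement_graph n (skeleton_graph \<Delta>)) 3"
      unfolding contains_complete_graph_def using abc
      by (intro exI[of _ "{a, b, c}"]) auto
  qed
qed


section \<open>Sufficiency of the four conditions\<close>

lemma card_4_iff: "card S = 4 \<longleftrightarrow> (\<exists>a b c d. S = {a, b, c, d} \<and> distinct [a, b, c, d])"
proof
  assume "card S = 4"
  then have "card S = Suc 3" by simp
  then obtain a T where "S = insert a T" "a \<notin> T" "card T = 3"
    unfolding card_Suc_eq by blast
  then obtain b c d where "T = {b, c, d}" "distinct [b, c, d]" by (auto simp: card_3_iff)
  with \<open>S = insert a T\<close> \<open>a \<notin> T\<close> have "S = {a, b, c, d} \<and> distinct [a, b, c, d]" by simp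
  then show "\<exists>a b c d. S = {a, b, c, d} \<and> distinct [a, b, c, d]" by blast
qed auto

text \<open>With \<open>V\<close> and \<open>W\<close> as below, \<open>c4\<close> settles
  \<open>card V \<ge> 5\<close>, and \<open>c1\<close>, \<open>c3\<close>, \<open>c2\<close> settle
  the sizes (3,0), (4,0), (4,1) of (\<open>V\<close>,\<open>W\<close>). For (3,1) and (4,2) the
  nonfaces supplied by \<open>small\<close> already form a covering pair.\<close>

lemma covered_if_conditions:
  assumes sc: "simplicial_complex n \<Delta>"
    and c1: "\<And>a b c. {a, b, c} \<subseteq> {1..n} \<Longrightarrow> distinct [a, b, c] \<Longrightarrow>
      {a, b} \<in> \<Delta> \<or> {a, c} \<in> \<Delta> \<or> {b, c} \<in> \<Delta>"
    and c2: "\<And>a b c d. {a, b, c, d} \<subseteq> {1..n} \<Longrightarrow> distinct [a, b, c, d] \<Longrightarrow>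
      {a, b, c} \<notin> \<Delta> \<Longrightarrow> {a, b, d} \<notin> \<Delta> \<Longrightarrow> {a, c, d} \<notin> \<Delta> \<Longrightarrow>
      {a, b} \<notin> \<Delta> \<or> {a, c} \<notin> \<Delta> \<or> {a, d} \<notin> \<Delta>"
    and c3: "\<And>a b c d. {a, b, c, d} \<subseteq> {1..n} \<Longrightarrow> distinct [a, b, c, d] \<Longrightarrow>
      {a, b, c} \<notin> \<Delta> \<Longrightarrow> {a, b, d} \<notin> \<Delta> \<Longrightarrow> {a, c, d} \<notin> \<Delta> \<Longrightarrow> {b, c, d} \<notin> \<Delta> \<Longrightarrow>
      partitioned_into_nonfaces n \<Delta> {a, b, c, d} 2 2"
    and c4: "\<And>W. W \<subseteq> {1..n} \<Longrightarrow> card W = 5 \<Longrightarrow> partitioned_into_nonfaces n \<Delta> W 2 3"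
    and supp: "{i. 0 < m i} \<subseteq> {1..n}"
    and sym: "\<And>F. F \<in> \<Delta> \<Longrightarrow> \<exists>i. \<exists>j. i \<notin> F \<and> j \<notin> F \<and> covers m {i} {j}"
  shows "\<exists>S\<in>nonfaces n \<Delta>. \<exists>T\<in>nonfaces n \<Delta>. covers m S T"
proof -
  define V where "V = {i. 0 < m i}"
  define W where "W = {i. 2 \<le> m i}"
  have V: "V \<subseteq> {1..n}" "finite V"
    using supp finite_subset[OF supp] by (simp_all add: V_def)
  have WV: "W \<subseteq> V" by (auto simp: V_def W_def)
  have nonface: "S \<in> nonfaces n \<Delta> \<longleftrightarrow> S \<notin> \<Delta>" if "S \<subseteq> V" for S
    using that V(1) by (auto simp: nonfaces_def)
  \<comment> \<open>Nonfaces inside the support may overlap only where the exponent is at least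
    2.\<close>
  have cov: ?thesis if "S \<notin> \<Delta>" "T \<notin> \<Delta>" "S \<subseteq> V" "T \<subseteq> V" "S \<inter> T \<subseteq> W" for S T
  proof (intro bexI)
    show "covers m S T"
      using that by (intro coversI) (auto simp: V_def W_def)
  qed (use that nonface in auto)
  have part: ?thesis if p: "partitioned_into_nonfaces n \<Delta> U r s" and "U \<subseteq> V" for U r s
  proof -
    obtain A B where "A \<in> nonfaces n \<Delta>" "B \<in> nonfaces n \<Delta>" "A \<union> B = U" "A \<inter> B = {}"
      using p unfolding partitioned_into_nonfaces_def by blast
    then show ?thesis using cov[of A B] \<open>U \<subseteq> V\<close> by (auto simp: nonfaces_def)
  qed
  \<comment> \<open>An index outside \<open>F \<supseteq> W\<close> has exponent at most 1, so it
    cannot serve twice and \<open>i\<close>, \<open>j\<close> are distinct.\<close>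
  have two: "2 \<le> card (V - F)" if "F \<in> \<Delta>" "W \<subseteq> F" for F
  proof -
    obtain i j where ij: "i \<notin> F" "j \<notin> F" "covers m {i} {j}"
      using sym[OF \<open>F \<in> \<Delta>\<close>] by blast
    then have "{i, j} \<subseteq> V - F" using covers_pos[OF ij(3)] by (auto simp: V_def)
    moreover have "i \<noteq> j"
      using covers_ge_2[OF ij(3)] that(2) ij(1) by (auto simp: W_def)
    ultimately show ?thesis using card_mono[of "V - F" "{i, j}"] V(2) by simp
  qed
  consider "W \<notin> \<Delta>" | "5 \<le> card V" | "W \<in> \<Delta>" "card V \<le> 4" by linarith
  then show ?thesis
  proof cases
    case 1
    \<comment> \<open>The nonface \<open>W\<close> is used twice, since the square of its monomial
      divides.\<close>
    then show ?thesis using cov[of W W] WV by blast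
  next
    case 2
    then obtain U where "U \<subseteq> V" "card U = 5"
      using obtain_subset_with_card_n by metis
    then show ?thesis using part c4 V(1) by blast
  next
    case 3
    have small: "F \<notin> \<Delta>" if "W \<subseteq> F" "F \<subseteq> V" "card V \<le> Suc (card F)" for F
    proof
      assume "F \<in> \<Delta>"
      then have "2 \<le> card (V - F)" using two that by blast
      moreover have "card (V - F) = card V - card F"
        using that V(2) by (simp add: card_Diff_subset finite_subset)
      ultimately show False using that(3) by linarith
    qed
    have cW: "card W + 2 \<le> card V"
      using two[OF 3(1)] card_Diff_subset[of W V] WV V(2) finite_subset[of W V] card_mono[of V W]
      by simp
    \<comment> \<open>Here \<open>W\<close> would be empty and \<open>small\<close> would turn a
      single vertex into a nonface.\<close>
    have "card V \<noteq> 2"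
    proof
      assume "card V = 2"
      then obtain a b where ab: "V = {a, b}" by (auto simp: card_2_iff)
      have "W = {}" using cW \<open>card V = 2\<close> WV V(2) finite_subset[of W V] by simp
      then have "{a} \<notin> \<Delta>" using small[of "{a}"] \<open>card V = 2\<close> ab by simp
      then show False using sc V(1) ab by (simp add: simplicial_complex_def)
    qed
    then consider "card V = 3" "card W = 0" | "card V = 3" "card W = 1" |
      "card V = 4" "card W = 0" | "card V = 4" "card W = 1" | "card V = 4" "card W = 2"
      using cW 3 by linarith
    then show ?thesis
    proof cases
      case 1
      then obtain a b c where abc: "V = {a, b, c}" "distinct [a, b, c]"
        by (auto simp: card_3_iff)
      have W: "W = {}" using 1 WV V(2) finite_subset[of W V] by simp
      have "{a, b} \<notin> \<Delta>" "{a, c} \<notin> \<Delta>" "{b, c} \<notin> \<Delta>"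
        by (rule small; use abc W in auto)+
      then show ?thesis using c1[of a b c] abc V(1) by blast
    next
      case 2
      then obtain a where a: "W = {a}" by (auto simp: card_1_singleton_iff)
      then have "card (V - {a}) = 2" using 2 WV V(2) by simp
      then obtain b c where bc: "V - {a} = {b, c}" "b \<noteq> c" by (auto simp: card_2_iff)
      then have abc: "V = {a, b, c}" "distinct [a, b, c]" using a WV by auto
      have "{a, b} \<notin> \<Delta>" "{a, c} \<notin> \<Delta>" by (rule small; use abc a in auto)+
      \<comment> \<open>The two pairs meet only in \<open>a\<close>, the vertex of exponent at least
        2.\<close>
      then show ?thesis using cov[of "{a, b}" "{a, c}"] abc a by auto
    next
      case 3
      then obtain a b c d where abcd: "V = {a, b, c, d}" "distinct [a, b, c, d]"
        by (auto simp: card_4_iff)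
      have W: "W = {}" using 3 WV V(2) finite_subset[of W V] by simp
      have "{a, b, c} \<notin> \<Delta>" "{a, b, d} \<notin> \<Delta>" "{a, c, d} \<notin> \<Delta>" "{b, c, d} \<notin> \<Delta>"
        by (rule small; use abcd W in auto)+
      then show ?thesis using part[OF c3[of a b c d]] abcd V(1) by simp
    next
      case 4
      then obtain a where a: "W = {a}" by (auto simp: card_1_singleton_iff)
      then have "card (V - {a}) = 3" using 4 WV V(2) by simp
      then obtain b c d where bcd: "V - {a} = {b, c, d}" "distinct [b, c, d]"
        by (auto simp: card_3_iff)
      then have abcd: "V = {a, b, c, d}" "distinct [a, b, c, d]" using a WV by auto
      have t: "{a, b, c} \<notin> \<Delta>" "{a, b, d} \<notin> \<Delta>" "{a, c, d} \<notin> \<Delta>"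
        by (rule small; use abcd a in auto)+
      \<comment> \<open>Whichever pair through \<open>a\<close> is a nonface, it is matched with the
        triple formed by \<open>a\<close> and the other two vertices; they share only
        \<open>a\<close>.\<close>
      then consider "{a, b} \<notin> \<Delta>" | "{a, c} \<notin> \<Delta>" | "{a, d} \<notin> \<Delta>"
        using c2[of a b c d] abcd V(1) by blast
      then show ?thesis
      proof cases
        case 1
        then show ?thesis using cov[of "{a, b}" "{a, c, d}"] t a abcd by auto
      next
        case 2
        then show ?thesis using cov[of "{a, c}" "{a, b, d}"] t a abcd by auto
      next
        case 3
        then show ?thesis using cov[of "{a, d}" "{a, b, c}"] t a abcd by auto
      qed
    next
      case 5
      then obtain a b where ab: "W = {a, b}" "a \<noteq> b" by (auto simp: card_2_iff)
      then have "card (V - {a, b}) = 2"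
        using 5 WV V(2) card_Diff_subset[of W V] by simp
      then obtain c d where cd: "V - {a, b} = {c, d}" "c \<noteq> d" by (auto simp: card_2_iff)
      then have abcd: "V = {a, b, c, d}" "distinct [a, b, c, d]" using ab WV by auto
      have "{a, b, c} \<notin> \<Delta>" "{a, b, d} \<notin> \<Delta>" by (rule small; use abcd ab in auto)+
      then show ?thesis using cov[of "{a, b, c}" "{a, b, d}"] abcd ab by auto
    qed
  qed
qed

section \<open>Necessity of the four conditions\<close>

lemma nonface_card_ge_2:
  assumes "simplicial_complex n \<Delta>" "S \<in> nonfaces n \<Delta>"
  shows "2 \<le> card S"
proof (rule ccontr)
  assume "\<not> 2 \<le> card S"
  moreover have "finite S" using assms(2) finite_subset by (auto simp: nonfaces_def)
  ultimately have "S = {} \<or> (\<exists>a. S = {a})"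
    by (metis One_nat_def card_0_eq card_1_singletonE less_2_cases not_le)
  moreover have "{} \<in> \<Delta>" using assms(1) by (auto simp: simplicial_complex_def)
  ultimately show False using assms by (auto simp: simplicial_complex_def nonfaces_def)
qed

lemma covers_of_bool_iff: "covers (\<lambda>i. of_bool (i \<in> U)) S T \<longleftrightarrow> S \<union> T \<subseteq> U \<and> S \<inter> T = {}"
  by (auto simp: covers_def of_bool_def split: if_splits)

text \<open>Two distinct elements of \<open>U - F\<close> are the required pair. This is the test
  for the squarefree monomial on \<open>U\<close> to lie in the symbolic square.\<close>

lemma covers_singletons_of_bool:
  assumes "finite U" "finite F" "card (U \<inter> F) + 2 \<le> card U"
  shows "\<exists>i. \<exists>j. i \<notin> F \<and> j \<notin> F \<and> covers (\<lambda>i. of_bool (i \<in> U)) {i} {j}"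
proof -
  have "card (U - F) = card U - card (U \<inter> F)"
    by (simp add: assms card_Diff_subset_Int)
  then have "2 \<le> card (U - F)" using assms(3) by linarith
  then obtain X where "X \<subseteq> U - F" "card X = 2"
    using obtain_subset_with_card_n by metis
  then obtain i j where "{i, j} \<subseteq> U - F" "i \<noteq> j" by (auto simp: card_2_iff)
  then show ?thesis by (intro exI[of _ i] exI[of _ j]) (auto simp: covers_of_bool_iff)
qed

text \<open>A suitable \<open>m\<close> is fed to \<open>covered\<close>; since nonfaces have at
  least two vertices, counting either forces the resulting pair into the desired shape or gives a
  contradiction. The bound on faces enters for five vertices.\<close>

lemma conditions_if_covered:
  assumes sc: "simplicial_complex n \<Delta>"
    and dim: "\<And>F. F \<in> \<Delta> \<Longrightarrow> card F \<le> 3"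
    and covered: "\<And>m. {i. 0 < m i} \<subseteq> {1..n} \<Longrightarrow>
      (\<And>F. F \<in> \<Delta> \<Longrightarrow> \<exists>i. \<exists>j. i \<notin> F \<and> j \<notin> F \<and> covers m {i} {j}) \<Longrightarrow>
      \<exists>S\<in>nonfaces n \<Delta>. \<exists>T\<in>nonfaces n \<Delta>. covers m S T"
  shows "distinct [a, b, c] \<Longrightarrow> {a, b, c} \<subseteq> {1..n} \<Longrightarrow>
      {a, b} \<in> \<Delta> \<or> {a, c} \<in> \<Delta> \<or> {b, c} \<in> \<Delta>" (is "_ \<Longrightarrow> _ \<Longrightarrow> ?C1")
    and "distinct [a, b, c, d] \<Longrightarrow> {a, b, c, d} \<subseteq> {1..n} \<Longrightarrow>
      {a, b, c} \<notin> \<Delta> \<Longrightarrow> {a, b, d} \<notin> \<Delta> \<Longrightarrow> {a, c, d} \<notin> \<Delta> \<Longrightarrow>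
      {a, b} \<notin> \<Delta> \<or> {a, c} \<notin> \<Delta> \<or> {a, d} \<notin> \<Delta>" (is "_ \<Longrightarrow> _ \<Longrightarrow> _ \<Longrightarrow> _ \<Longrightarrow> _ \<Longrightarrow> ?C2")
    and "distinct [a, b, c, d] \<Longrightarrow> {a, b, c, d} \<subseteq> {1..n} \<Longrightarrow>
      {a, b, c} \<notin> \<Delta> \<Longrightarrow> {a, b, d} \<notin> \<Delta> \<Longrightarrow> {a, c, d} \<notin> \<Delta> \<Longrightarrow> {b, c, d} \<notin> \<Delta> \<Longrightarrow>
      partitioned_into_nonfaces n \<Delta> {a, b, c, d} 2 2"
    and "U \<subseteq> {1..n} \<Longrightarrow> card U = 5 \<Longrightarrow> partitioned_into_nonfaces n \<Delta> U 2 3"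
proof -
  have fin: "finite F" if "F \<in> \<Delta>" for F
    using that sc finite_subset[of F "{1..n}"] by (auto simp: simplicial_complex_def)
  have down: "G \<in> \<Delta>" if "F \<in> \<Delta>" "G \<subseteq> F" for F G
    using that sc by (auto simp: simplicial_complex_def)
  have squarefree: "\<exists>S\<in>nonfaces n \<Delta>. \<exists>T\<in>nonfaces n \<Delta>. S \<union> T \<subseteq> U \<and> S \<inter> T = {}"
    if U: "U \<subseteq> {1..n}" and "\<And>G. G \<subseteq> U \<Longrightarrow> G \<in> \<Delta> \<Longrightarrow> card G + 2 \<le> card U" for U
    unfolding covers_of_bool_iff[symmetric]
  proof (rule covered)
    fix F assume F: "F \<in> \<Delta>"
    have "card (U \<inter> F) + 2 \<le> card U"
      using that(2)[of "U \<inter> F"] down[OF F] by simp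
    then show "\<exists>i. \<exists>j. i \<notin> F \<and> j \<notin> F \<and> covers (\<lambda>i. of_bool (i \<in> U)) {i} {j}"
      using covers_singletons_of_bool fin[OF F] finite_subset[OF U] by blast
  qed (use U in auto)
  \<comment> \<open>Two disjoint nonfaces inside a set of four vertices must have two elements each
    and fill it.\<close>
  have partition: "S \<union> T = U \<and> (card S = 2 \<and> card T = card U - 2)"
    if "S \<in> nonfaces n \<Delta>" "T \<in> nonfaces n \<Delta>" "S \<union> T \<subseteq> U" "S \<inter> T = {}" "card U = 4"
      "U \<subseteq> {1..n}" for S T U
  proof -
    have "finite U" using that(6) finite_subset by blast
    then have "finite S" "finite T" using that(3) finite_subset by auto
    then have "card (S \<union> T) = card S + card T" using that(4) by (simp add: card_Un_disjoint)
    moreover have "card (S \<union> T) \<le> card U" using \<open>finite U\<close> that(3) card_mono by blast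
    moreover have "2 \<le> card S" "2 \<le> card T" using nonface_card_ge_2[OF sc] that by auto
    ultimately have "card (S \<union> T) = card U" "card S = 2" "card T = 2" using that(5) by auto
    then show ?thesis using card_subset_eq[OF \<open>finite U\<close> that(3)] that(5) by simp
  qed
  {
    assume abc: "distinct [a, b, c]" "{a, b, c} \<subseteq> {1..n}"
    show ?C1
    proof (rule ccontr)
      assume not_C1: "\<not> ?C1"
      \<comment> \<open>A face with two of the three vertices would contain one of the pairs assumed
        to be nonfaces. The covering pair would then need four vertices out of three.\<close>
      have "card G + 2 \<le> card {a, b, c}" if "G \<subseteq> {a, b, c}" "G \<in> \<Delta>" for G
      proof (rule ccontr)
        assume "\<not> ?thesis"
        then have "2 \<le> card G" using abc(1) by simp
        then obtain X where "X \<subseteq> G" "card X = 2" using obtain_subset_with_card_n by metis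
        then obtain x y where "{x, y} \<subseteq> G" "x \<noteq> y" by (auto simp: card_2_iff)
        then have "{x, y} = {a, b} \<or> {x, y} = {a, c} \<or> {x, y} = {b, c}"
          using that(1) by auto
        then show False using down[OF that(2) \<open>{x, y} \<subseteq> G\<close>] not_C1 by auto
      qed
      from squarefree[OF abc(2) this] obtain S T where ST: "S \<in> nonfaces n \<Delta>"
        "T \<in> nonfaces n \<Delta>" "S \<union> T \<subseteq> {a, b, c}" "S \<inter> T = {}" by blast
      then have "card S + card T \<le> card {a, b, c}"
        by (metis card_Un_disjoint card_mono finite.emptyI finite.insertI finite_subset le_sup_iff)
      moreover have "card {a, b, c} = 3" using abc(1) by simp
      ultimately show False
        using nonface_card_ge_2[OF sc ST(1)] nonface_card_ge_2[OF sc ST(2)] by linarith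
    qed
  next
    assume abcd: "distinct [a, b, c, d]" "{a, b, c, d} \<subseteq> {1..n}"
      and non: "{a, b, c} \<notin> \<Delta>" "{a, b, d} \<notin> \<Delta>" "{a, c, d} \<notin> \<Delta>"
    show ?C2
    proof (rule ccontr)
      assume not_C2: "\<not> ?C2"
      let ?m = "\<lambda>i. of_bool (i \<in> {a, b, c, d}) + of_bool (i = a) :: nat"
      \<comment> \<open>A face avoiding \<open>a\<close> is handled by taking \<open>a\<close>
        twice; one containing \<open>a\<close> holds at most one of \<open>b\<close>,
        \<open>c\<close>, \<open>d\<close>, because the triples through \<open>a\<close> are
        nonfaces.\<close>
      have sym: "\<exists>i. \<exists>j. i \<notin> F \<and> j \<notin> F \<and> covers ?m {i} {j}" if F: "F \<in> \<Delta>" for F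
      proof (cases "a \<in> F")
        case False
        moreover have "covers ?m {a} {a}" by (rule coversI) auto
        ultimately show ?thesis by blast
      next
        case True
        have "\<not> {a, b, c} \<subseteq> F" "\<not> {a, b, d} \<subseteq> F" "\<not> {a, c, d} \<subseteq> F"
          using non down[OF F] by metis+
        with True have "{b, c} \<inter> F = {} \<or> {b, d} \<inter> F = {} \<or> {c, d} \<inter> F = {}"
          by auto
        moreover have "covers ?m {b} {c}" "covers ?m {b} {d}" "covers ?m {c} {d}"
          using abcd(1) by (intro coversI; simp)+
        ultimately show ?thesis
          by (metis disjoint_insert(1) inf_commute)
      qed
      have supp: "{i. 0 < ?m i} \<subseteq> {1..n}" using abcd(2) by auto
      obtain S T where ST: "S \<in> nonfaces n \<Delta>" "T \<in> nonfaces n \<Delta>" "covers ?m S T"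
        using covered[OF supp sym] by blast
      have sub: "S \<subseteq> {a, b, c, d}" "T \<subseteq> {a, b, c, d}"
        using covers_pos[OF ST(3)] by force+
      have int: "S \<inter> T \<subseteq> {a}"
        using covers_ge_2[OF ST(3)] by (fastforce simp: of_bool_def split: if_splits)
      \<comment> \<open>By \<open>not_C2\<close> all pairs through \<open>a\<close> are faces, so a
        nonface needs two of \<open>b\<close>, \<open>c\<close>, \<open>d\<close>. As
        \<open>S\<close> and \<open>T\<close> are disjoint there, this asks for four elements out of
        three.\<close>
      have bcd: "2 \<le> card (X \<inter> {b, c, d})" if "X \<in> nonfaces n \<Delta>" "X \<subseteq> {a, b, c, d}" for X
      proof (rule ccontr)
        assume "\<not> ?thesis"
        then consider "card (X \<inter> {b, c, d}) = 0" | "card (X \<inter> {b, c, d}) = 1" by linarith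
        then obtain x where "X \<inter> {b, c, d} \<subseteq> {x}" "x \<in> {b, c, d}"
        proof cases
          case 2
          then obtain y where y: "X \<inter> {b, c, d} = {y}" by (rule card_1_singletonE)
          then have "y \<in> {b, c, d}" by blast
          then show thesis using that y by blast
        qed (use that in auto)
        then have "X \<subseteq> {a, x}" "{a, x} \<in> \<Delta>" using that(2) not_C2 by auto
        then show False using down that(1) by (auto simp: nonfaces_def)
      qed
      have "(S \<inter> {b, c, d}) \<inter> (T \<inter> {b, c, d}) = {}" using int abcd(1) by auto
      then have "card (S \<inter> {b, c, d}) + card (T \<inter> {b, c, d})
          = card (S \<inter> {b, c, d} \<union> T \<inter> {b, c, d})"
        by (simp add: card_Un_disjoint)
      also have "\<dots> \<le> card {b, c, d}" by (rule card_mono) auto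
      also have "\<dots> \<le> 3" using abcd(1) by simp
      finally show False using bcd[OF ST(1) sub(1)] bcd[OF ST(2) sub(2)] by linarith
    qed
  next
    assume abcd: "distinct [a, b, c, d]" "{a, b, c, d} \<subseteq> {1..n}"
      and non: "{a, b, c} \<notin> \<Delta>" "{a, b, d} \<notin> \<Delta>" "{a, c, d} \<notin> \<Delta>" "{b, c, d} \<notin> \<Delta>"
    have card: "card {a, b, c, d} = 4" using abcd(1) by simp
    have "card G + 2 \<le> card {a, b, c, d}" if "G \<subseteq> {a, b, c, d}" "G \<in> \<Delta>" for G
    proof (rule ccontr)
      assume "\<not> ?thesis"
      then have "3 \<le> card G" using card by linarith
      then obtain X where X: "X \<subseteq> G" "card X = 3" using obtain_subset_with_card_n by metis
      then have "card ({a, b, c, d} - X) = 1"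
        using that(1) card card_Diff_subset[of X "{a, b, c, d}"] finite_subset[of X "{a, b, c, d}"]
        by simp
      then obtain x where "{a, b, c, d} - X = {x}" by (rule card_1_singletonE)
      then have "x \<in> {a, b, c, d}" "{a, b, c, d} - {x} \<subseteq> X" by auto
      then have "{a, b, c} \<subseteq> X \<or> {a, b, d} \<subseteq> X \<or> {a, c, d} \<subseteq> X \<or> {b, c, d} \<subseteq> X"
        using abcd(1) by auto
      then show False using down[OF that(2)] X(1) non by blast
    qed
    from squarefree[OF abcd(2) this] obtain S T where ST: "S \<in> nonfaces n \<Delta>" "T \<in> nonfaces n \<Delta>"
      "S \<union> T \<subseteq> {a, b, c, d}" "S \<inter> T = {}" by blast
    then show "partitioned_into_nonfaces n \<Delta> {a, b, c, d} 2 2"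
      using partition[OF ST card abcd(2)] card unfolding partitioned_into_nonfaces_def by auto
  next
    assume U: "U \<subseteq> {1..n}" "card U = 5"
    have "finite U" using U(1) finite_subset by blast
    \<comment> \<open>Faces have at most 3 = 5 - 2 vertices.\<close>
    have "card G + 2 \<le> card U" if "G \<in> \<Delta>" for G using dim[OF that] U(2) by simp
    from squarefree[OF U(1) this] obtain S T where ST: "S \<in> nonfaces n \<Delta>" "T \<in> nonfaces n \<Delta>"
      "S \<union> T \<subseteq> U" "S \<inter> T = {}" by blast
    \<comment> \<open>\<open>S\<close> and \<open>T\<close> may leave a vertex of \<open>U\<close>
      uncovered. Enlarging one of them to the complement of the other keeps it a nonface, because
      \<open>\<Delta>\<close> is closed under subsets.\<close>
    have complement: "U - X \<in> nonfaces n \<Delta> \<and> card (U - X) = 3"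
      if "Y \<in> nonfaces n \<Delta>" "X \<union> Y \<subseteq> U" "X \<inter> Y = {}" "card X = 2" for X Y
    proof -
      have "Y \<subseteq> U - X" using that by blast
      then have "U - X \<notin> \<Delta>" using that(1) down by (auto simp: nonfaces_def)
      moreover have "card (U - X) = 3"
        using that U(2) \<open>finite U\<close> card_Diff_subset[of X U] finite_subset[of X U] by simp
      ultimately show ?thesis using U(1) by (auto simp: nonfaces_def)
    qed
    have "card S + card T \<le> 5"
      using ST U(2) \<open>finite U\<close>
      by (metis card_Un_disjoint card_mono finite_subset le_sup_iff)
    moreover have "2 \<le> card S" "2 \<le> card T" using nonface_card_ge_2[OF sc] ST by auto
    ultimately consider "card S = 2" | "card T = 2" by linarith
    then obtain X where "X \<in> nonfaces n \<Delta>" "X \<subseteq> U" "card X = 2"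
      "U - X \<in> nonfaces n \<Delta> \<and> card (U - X) = 3"
    proof cases
      case 1
      then show thesis using that[of S] complement[of T S] ST by blast
    next
      case 2
      then show thesis using that[of T] complement[of S T] ST by blast
    qed
    then show "partitioned_into_nonfaces n \<Delta> U 2 3"
      unfolding partitioned_into_nonfaces_def
      by (intro bexI[of _ X] bexI[of _ "U - X"]) auto
  }
qed

section \<open>Dimension bound and conclusion\<close>

lemma card_face_le_3:
  assumes "simplicial_complex n \<Delta>" "complex_dim \<Delta> = 2" "F \<in> \<Delta>"
  shows "card F \<le> 3"
proof -
  have "finite \<Delta>"
    using assms(1) finite_subset[of \<Delta> "Pow {1..n}"] by (simp add: simplicial_complex_def)
  then have "face_dim F \<le> complex_dim \<Delta>"
    using assms(3) by (simp add: complex_dim_def)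
  then show ?thesis using assms(2) by (simp add: face_dim_def)
qed

theorem theorem2p2:
  fixes n :: nat and \<Delta> :: "nat set set"
  assumes "n \<ge> 6"
    and "simplicial_complex n \<Delta>"
    and "pure \<Delta>"
    and "complex_dim \<Delta> = 2"
  shows "(symbolic_power n \<Delta> 2 :: 'k::field mpoly set)
           = ideal_power n (stanley_reisner_ideal n \<Delta>) 2
    \<longleftrightarrow>
      \<not> contains_complete_graph n (complement_graph n (skeleton_graph \<Delta>)) 3
    \<and> (\<forall>a \<in> {1..n}. \<forall>b \<in> {1..n}. \<forall>c \<in> {1..n}. \<forall>d \<in> {1..n}.
         distinct [a, b, c, d] \<and> {a, b, c} \<notin> \<Delta> \<and> {a, b, d} \<notin> \<Delta> \<and> {a, c, d} \<notin> \<Delta>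
         \<longrightarrow> {a, b} \<notin> \<Delta> \<or> {a, c} \<notin> \<Delta> \<or> {a, d} \<notin> \<Delta>)
    \<and> (\<forall>a \<in> {1..n}. \<forall>b \<in> {1..n}. \<forall>c \<in> {1..n}. \<forall>d \<in> {1..n}.
         distinct [a, b, c, d] \<and> {a, b, c} \<notin> \<Delta> \<and> {a, b, d} \<notin> \<Delta> \<and> {a, c, d} \<notin> \<Delta>
           \<and> {b, c, d} \<notin> \<Delta>
         \<longrightarrow> partitioned_into_nonfaces n \<Delta> {a, b, c, d} 2 2)
    \<and> (\<forall>W \<subseteq> {1..n}. card W = 5 \<longrightarrow> partitioned_into_nonfaces n \<Delta> W 2 3)"
proof -
  note sc = assms(2)
  note dim = card_face_le_3[OF assms(2, 4)]
  have sub: "\<Delta> \<subseteq> Pow {1..n}" using sc by (simp add: simplicial_complex_def)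
  show ?thesis (is "?L \<longleftrightarrow> ?conditions")
  proof
    assume ?L
    then have covered: "\<exists>S\<in>nonfaces n \<Delta>. \<exists>T\<in>nonfaces n \<Delta>. covers m S T"
      if "{i. 0 < m i} \<subseteq> {1..n}"
        "\<And>F. F \<in> \<Delta> \<Longrightarrow> \<exists>i. \<exists>j. i \<notin> F \<and> j \<notin> F \<and> covers m {i} {j}" for m
      using that unfolding symbolic_square_eq_square_iff[OF sc] by blast
    note conditions = conditions_if_covered[OF sc dim covered]
    show ?conditions
      unfolding contains_triangle_complement_iff[OF sub]
    proof (intro conjI ballI allI impI)
      show "\<not> (\<exists>a\<in>{1..n}. \<exists>b\<in>{1..n}. \<exists>c\<in>{1..n}. distinct [a, b, c] \<and>
          {a, b} \<notin> \<Delta> \<and> {a, c} \<notin> \<Delta> \<and> {b, c} \<notin> \<Delta>)"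
        using conditions(1) by (meson empty_subsetI insert_subset)
    next
      fix a b c d
      assume vertices: "a \<in> {1..n}" "b \<in> {1..n}" "c \<in> {1..n}" "d \<in> {1..n}"
      {
        assume "distinct [a, b, c, d] \<and> {a, b, c} \<notin> \<Delta> \<and> {a, b, d} \<notin> \<Delta> \<and> {a, c, d} \<notin> \<Delta>"
        then show "{a, b} \<notin> \<Delta> \<or> {a, c} \<notin> \<Delta> \<or> {a, d} \<notin> \<Delta>"
          using vertices by (intro conditions(2)) blast+
      next
        assume "distinct [a, b, c, d] \<and> {a, b, c} \<notin> \<Delta> \<and> {a, b, d} \<notin> \<Delta> \<and> {a, c, d} \<notin> \<Delta>
          \<and> {b, c, d} \<notin> \<Delta>"
        then show "partitioned_into_nonfaces n \<Delta> {a, b, c, d} 2 2"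
          using vertices by (intro conditions(3)) blast+
      }
    qed (rule conditions(4))
  next
    assume ?conditions
    note conditions = this[unfolded contains_triangle_complement_iff[OF sub]]
    note c1 = conjunct1[OF conditions]
      and c2 = conjunct1[OF conjunct2[OF conditions], rule_format]
      and c3 = conjunct1[OF conjunct2[OF conjunct2[OF conditions]], rule_format]
      and c4 = conjunct2[OF conjunct2[OF conjunct2[OF conditions]], rule_format]
    show ?L
      unfolding symbolic_square_eq_square_iff[OF sc]
    \<comment> \<open>The first four goals are the four conditions; the last two, on the support and
      the symbolic square, are assumptions.\<close>
    proof (intro allI impI, rule covered_if_conditions[OF sc], goal_cases)
      case (1 m a b c)
      then show ?case using c1 by (meson insert_subset)
    next
      case (2 m a b c d)
      then show ?case by (intro c2) simp_all
    next
      case (3 m a b c d)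
      then show ?case by (intro c3) simp_all
    next
      case (4 m W)
      then show ?case by (intro c4)
    qed blast+
  qed
qed

end
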